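(* Let $l_x,l_y,l_z$ be real numbers with $0\le l_xl_y<l_z<1$, $l_z\le l_x<1$ and $l_z\le l_y<1$, and let $\mathcal F'=\{(x,y,z)\in\mathbb R^3 : z=xy,\ l_x\le x\le 1,\ l_y\le y\le 1,\ l_z\le z\le 1\}$. Let $$M=\begin{pmatrix}1 & 2l_z-1\\ 2l_z-1 & 1\end{pmatrix}.$$ Then $M$ is positive semidefinite, and $\operatorname{conv}(\mathcal F')$ is exactly the set of $(x,y,z)\in\mathbb R^3$ satisfying the RLT constraints $$z\ge x+y-1,\qquad z\ge l_yx+l_xy-l_xl_y,\qquad z\le x+l_xy-l_x,\qquad z\le l_yx+y-l_y,$$ the bound $z\ge l_z$, and the second-order cone constraint $$\sqrt{(\hat x,\hat y)\,M\,(\hat x,\hat y)^T}\le x+y-2z,\qquad\text{where } \hat x:=1-x,\ \hat y:=1-y.$$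
   Context: $\operatorname{conv}$ denotes the convex hull in $\mathbb R^3$. "RLT" stands for Reformulation-Linearization Technique; the RLT constraints are written out in the claim for the box $l_x\le x\le 1$, $l_y\le y\le 1$. *)

theory Defs
  imports "HOL-Analysis.Analysis"
begin

definition pos_semidef :: "real ^ 'n ^ 'n \<Rightarrow> bool" where
  "pos_semidef M \<longleftrightarrow> transpose M = M \<and> (\<forall>v. 0 \<le> v \<bullet> (M *v v))"

definition F' :: "real \<Rightarrow> real \<Rightarrow> real \<Rightarrow> (real \<times> real \<times> real) set" where
  "F' lx ly lz =
     {(x, y, z). z = x * y \<and> lx \<le> x \<and> x \<le> 1 \<and> ly \<le> y \<and> y \<le> 1 \<and> lz \<le> z \<and> z \<le> 1}"

definition M_mat :: "real \<Rightarrow> real ^ 2 ^ 2" where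
  "M_mat lz = vector [vector [1, 2 * lz - 1], vector [2 * lz - 1, 1]]"

end

theory Submission
  imports Defs
begin

text \<open>
  In the coordinates \<open>u = 1 - x\<close>, \<open>v = 1 - y\<close>, \<open>w = z - x - y + 1\<close> and with \<open>a = 1 - l\<^sub>x\<close>,
  \<open>b = 1 - l\<^sub>y\<close>, \<open>s = 1 - l\<^sub>z\<close>, the set becomes \<open>w = u v\<close>, \<open>0 \<le> u \<le> a\<close>, \<open>0 \<le> v \<le> b\<close>,
  \<open>u + v - w \<le> s\<close>, and the second-order cone constraint becomes \<open>w (u + v - w) \<le> s u v\<close>, which is
  homogeneous. The only inhomogeneous constraints are \<open>u + v - w \<le> s\<close> and
  \<open>a v + b u - w \<le> a b\<close>. Since the origin belongs to the set, one may scale a given point up until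
  one of these two is tight. If the first is tight, the point lies in the planar region between
  the hyperbola arc \<open>(1 - u) (1 - v) = 1 - s\<close> and its chord; if the second is tight, it lies in a
  quadrilateral facet two of whose edges belong to the set.
\<close>

section \<open>Convex combinations\<close>

lemma convex_triple_combination:
  fixes T :: "(real \<times> real \<times> real) set"
  assumes "convex T" "(u1, v1, w1) \<in> T" "(u2, v2, w2) \<in> T" "0 \<le> k" "k \<le> 1"
    and "u = (1 - k) * u1 + k * u2" "v = (1 - k) * v1 + k * v2" "w = (1 - k) * w1 + k * w2"
  shows "(u, v, w) \<in> T"
  using convexD_alt[OF assms(1-5)] assms(6-8) by simp

lemma between_conv_comb:
  fixes p q r :: real
  assumes "p \<le> r" "r \<le> q"
  obtains k where "0 \<le> k" "k \<le> 1" "r = (1 - k) * p + k * q"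
proof (cases "p = q")
  case True
  then show ?thesis using assms that[of 0] by simp
next
  case False
  then have "p < q" using assms by simp
  define k where "k = (r - p) / (q - p)"
  have "k * (q - p) = r - p" using \<open>p < q\<close> by (simp add: k_def)
  then have "r = (1 - k) * p + k * q" by (simp add: algebra_simps)
  moreover have "0 \<le> k" "k \<le> 1" using assms \<open>p < q\<close> by (auto simp: k_def divide_simps)
  ultimately show ?thesis using that by blast
qed

section \<open>Points forced into every convex \<open>T\<close> that contains the truncated patch
  \<open>w = u * v\<close>\<close>

locale truncated_bilinear_patch =
  fixes a b s :: real and T :: "(real \<times> real \<times> real) set"
  assumes a: "0 < a" "a \<le> s" and b: "0 < b" "b \<le> s"
    and s: "s < 1" "s < a + b - a * b"
    and convex: "convex T"
    and patch: "\<And>u v. \<lbrakk>0 \<le> u; u \<le> a; 0 \<le> v; v \<le> b; u + v - u * v \<le> s\<rbrakk> \<Longrightarrow> (u, v, u * v) \<in> T"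
begin

lemma origin: "(0, 0, 0) \<in> T"
  using patch[of 0 0] a b by simp

text \<open>Solves \<open>a * v + b * u - a * b = u + v - s\<close> for \<open>v\<close>: along this
  line both inhomogeneous constraints are tight.\<close>

definition chord :: "real \<Rightarrow> real" where
  "chord u = (s - a * b - (1 - b) * u) / (1 - a)"

text \<open>The abscissa at which the hyperbola \<open>u + v - u * v = s\<close> meets the side
  \<open>v = b\<close>.\<close>

definition u_min :: real where
  "u_min = (s - b) / (1 - b)"

lemma chord_eq: "(1 - a) * chord u = s - a * b - (1 - b) * u"
  using a s by (simp add: chord_def)

lemma u_min: "(1 - b) * u_min = s - b" "0 \<le> u_min" "u_min < a"
proof -
  show "(1 - b) * u_min = s - b" "0 \<le> u_min"
    using b s by (simp_all add: u_min_def)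
  show "u_min < a"
    using b s by (simp add: u_min_def divide_simps) (simp add: algebra_simps)
qed

lemma chord_ends:
  "chord u_min = b" "(1 - a) * chord a = s - a" "0 \<le> chord a" "chord a \<le> b"
proof -
  have a1: "1 - a > 0" using a s by simp
  have "(1 - a) * chord u_min = (1 - a) * b"
    using chord_eq[of u_min] u_min(1) by (simp add: algebra_simps)
  then show "chord u_min = b" using a1 by simp
  show e: "(1 - a) * chord a = s - a"
    using chord_eq[of a] by (simp add: algebra_simps)
  then have "0 \<le> (1 - a) * chord a" using a by simp
  then show "0 \<le> chord a" using a1 by (simp add: zero_le_mult_iff)
  have "(1 - a) * chord a \<le> (1 - a) * b" using e s by (simp add: algebra_simps)
  then show "chord a \<le> b" using a1 by simp
qed

text \<open>Both ends of the chord lie on the hyperbola, hence on the patch, and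
  \<open>chord\<close> is affine.\<close>

lemma chord_mem:
  assumes "u_min \<le> u" "u \<le> a"
  shows "(u, chord u, u + chord u - s) \<in> T"
proof -
  obtain k where k: "0 \<le> k" "k \<le> 1" and u: "u = (1 - k) * u_min + k * a"
    using between_conv_comb assms by blast
  have end1: "(u_min, chord u_min, u_min + chord u_min - s) \<in> T"
  proof -
    have "u_min * b = u_min + b - s" using u_min(1) by (simp add: algebra_simps)
    then show ?thesis using patch[of u_min b] u_min chord_ends b by simp
  qed
  have end2: "(a, chord a, a + chord a - s) \<in> T"
  proof -
    have "a * chord a = a + chord a - s" using chord_ends(2) by (simp add: algebra_simps)
    then show ?thesis using patch[of a "chord a"] chord_ends a by simp
  qed
  have c: "chord u = (1 - k) * chord u_min + k * chord a"
    using a s by (simp add: chord_def u divide_simps) (simp add: algebra_simps)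
  have "u + chord u - s
      = (1 - k) * (u_min + chord u_min - s) + k * (a + chord a - s)"
    unfolding c by (subst u) (simp add: algebra_simps)
  then show ?thesis
    by (rule convex_triple_combination[OF convex end1 end2 k u c])
qed

text \<open>For fixed \<open>u\<close>, the point lies on a segment from the chord up to the
  hyperbola arc, inside the plane \<open>w = u + v - s\<close>.\<close>

lemma cap_mem:
  assumes cone: "u + v - s \<le> u * v" and chord: "a * v + b * u - a * b \<le> u + v - s"
    and "u < 1"
  shows "(u, v, u + v - s) \<in> T"
proof -
  have a1: "0 < 1 - a" and b1: "0 < 1 - b" and u1: "0 < 1 - u" using a b s assms by auto
  have above: "(1 - a) * chord u \<le> (1 - a) * v"
    using chord chord_eq[of u] by (simp add: algebra_simps)
  have below: "(1 - u) * v \<le> s - u" using cone by (simp add: algebra_simps)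
  \<comment> \<open>Eliminating \<open>v\<close> leaves a quadratic in \<open>u\<close> whose roots
    \<open>u_min\<close> and \<open>a\<close> are the crossings of chord and hyperbola.\<close>
  have "(1 - u) * ((1 - a) * chord u) \<le> (1 - u) * ((1 - a) * v)"
    using above u1 by simp
  also have "\<dots> \<le> (1 - a) * (s - u)"
    using mult_left_mono[OF below, of "1 - a"] a1 by (simp add: algebra_simps)
  finally have "(1 - u) * (s - a * b - (1 - b) * u) \<le> (1 - a) * (s - u)"
    unfolding chord_eq .
  then have "(u - a) * ((1 - b) * u - (s - b)) \<le> 0"
    by (simp add: algebra_simps)
  moreover have "(1 - b) * ((u - a) * (u - u_min)) = (u - a) * ((1 - b) * u - (1 - b) * u_min)"
    by (simp add: algebra_simps)
  ultimately have "(1 - b) * ((u - a) * (u - u_min)) \<le> 0"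
    unfolding u_min(1) by linarith
  then have "(u - a) * (u - u_min) \<le> 0" using b1 by (simp add: mult_le_0_iff)
  then have u: "u_min \<le> u" "u \<le> a"
    using u_min(3) by (auto simp: mult_le_0_iff)
  define v0 where "v0 = (s - u) / (1 - u)"
  have v0: "(1 - u) * v0 = s - u" using u1 by (simp add: v0_def)
  have "0 \<le> v0" using u a u1 by (simp add: v0_def)
  moreover have "v0 \<le> b"
  proof -
    have "(1 - b) * u_min \<le> (1 - b) * u" using u b1 by simp
    then have "s - u \<le> b * (1 - u)" using u_min(1) by (simp add: algebra_simps)
    then show ?thesis using u1 by (simp add: v0_def divide_simps)
  qed
  moreover have uv0: "u * v0 = u + v0 - s" using v0 by (simp add: algebra_simps)
  ultimately have arc: "(u, v0, u + v0 - s) \<in> T"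
    using patch[of u v0] u u_min(2) by simp
  have "chord u \<le> v" using above a1 by simp
  moreover have "v \<le> v0" using below u1 by (simp add: v0_def divide_simps mult.commute)
  ultimately obtain k where "0 \<le> k" "k \<le> 1" "v = (1 - k) * chord u + k * v0"
    using between_conv_comb by blast
  then show ?thesis
    using convex_triple_combination[OF convex chord_mem[OF u] arc, of k]
    by (simp add: algebra_simps)
qed

lemma facet_mem:
  assumes "0 \<le> a * v + b * u - a * b" "u \<le> a" "v \<le> b"
    and "u + v - (a * v + b * u - a * b) \<le> s"
  shows "(u, v, a * v + b * u - a * b) \<in> T"
proof -
  define p q where "p = a - u" and "q = b - v"
  have pq: "0 \<le> p" "0 \<le> q" using assms by (auto simp: p_def q_def)
  \<comment> \<open>The amount by which the corner \<open>(a, b, a * b)\<close> violates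
    \<open>u + v - w \<le> s\<close>.\<close>
  define d where "d = a + b - a * b - s"
  have d: "0 < d" "d \<le> a * (1 - b)" "d \<le> b * (1 - a)"
    using s a b by (auto simp: d_def algebra_simps)
  have upper: "b * p + a * q \<le> a * b" using assms(1) by (simp add: p_def q_def algebra_simps)
  have lower: "d \<le> (1 - b) * p + (1 - a) * q"
    using assms(4) by (simp add: p_def q_def d_def algebra_simps)
  \<comment> \<open>On the sides \<open>v = b\<close> and \<open>u = a\<close> the facet coincides
    with the surface \<open>w = u * v\<close>, so \<open>patch\<close> applies.\<close>
  have edge1: "(a - p', b, b * (a - p')) \<in> T" if "d \<le> (1 - b) * p'" "p' \<le> a" for p'
  proof -
    have "0 < (1 - b) * p'" using that d by linarith
    then have "0 < p'" using b s by (simp add: zero_less_mult_iff)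
    then show ?thesis
      using patch[of "a - p'" b] that b by (simp add: d_def algebra_simps)
  qed
  have edge2: "(a, b - q', a * (b - q')) \<in> T" if "d \<le> (1 - a) * q'" "q' \<le> b" for q'
  proof -
    have "0 < (1 - a) * q'" using that d by linarith
    then have "0 < q'" using a s by (simp add: zero_less_mult_iff)
    then show ?thesis
      using patch[of a "b - q'"] that a by (simp add: d_def algebra_simps)
  qed
  have eq: "(u, v, a * v + b * u - a * b) = (a - p, b - q, a * b - b * p - a * q)"
    by (simp add: p_def q_def algebra_simps)
  consider "p = 0" | "q = 0" | "0 < p" "0 < q" using pq by linarith
  then show ?thesis
  proof cases
    case 1
    then have "q \<le> b" using upper a by simp
    then show ?thesis using 1 edge2[of q] lower by (simp add: eq algebra_simps)
  next
    case 2
    then have "p \<le> a" using upper b by (simp add: mult.commute)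
    then show ?thesis using 2 edge1[of p] lower by (simp add: eq algebra_simps)
  next
    case 3
    \<comment> \<open>\<open>k\<close> weights a point at distance \<open>p / (1 - k)\<close> from the corner \<open>(a, b)\<close> on one edge
      against one at distance \<open>q / k\<close> on the other; both distances must be admissible.\<close>
    define k where "k = max (q / b) (1 - (1 - b) * p / d)"
    \<comment> \<open>Each lower bound on \<open>k\<close> must lie below each upper bound.
      \<open>r1\<close> and \<open>r2\<close> say that each edge has an admissible point, which is
      \<open>d \<le> a * (1 - b)\<close> and \<open>d \<le> b * (1 - a)\<close>.\<close>
    have sum1: "q / b \<le> 1 - p / a" using upper a b by (simp add: field_simps)
    have sum2: "1 - (1 - b) * p / d \<le> (1 - a) * q / d"
    proof -
      have "1 \<le> ((1 - b) * p + (1 - a) * q) / d" using lower d by simp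
      then show ?thesis by (simp add: add_divide_distrib)
    qed
    have r1: "1 - (1 - b) * p / d \<le> 1 - p / a"
      using mult_right_mono[OF d(2), of p] pq a d by (simp add: field_simps)
    have r2: "q / b \<le> (1 - a) * q / d"
      using mult_right_mono[OF d(3), of q] pq b d by (simp add: field_simps)
    have kq: "q / b \<le> k" and kp: "1 - (1 - b) * p / d \<le> k"
      and kp': "k \<le> 1 - p / a" and kq': "k \<le> (1 - a) * q / d"
      using sum1 sum2 r1 r2 by (auto simp: k_def)
    have "0 < q / b" "0 < p / a" using 3 a b by simp_all
    then have k: "0 < k" "k < 1" using kq kp' by linarith+
    define p' q' where "p' = p / (1 - k)" and "q' = q / k"
    have scale: "p = (1 - k) * p'" "q = k * q'" using k by (simp_all add: p'_def q'_def)
    have "(a - p', b, b * (a - p')) \<in> T"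
    proof (rule edge1)
      have "(1 - k) * d \<le> (1 - b) * p" using kp d by (simp add: field_simps)
      then have "(1 - k) * d \<le> (1 - k) * ((1 - b) * p')" by (simp add: scale ac_simps)
      then show "d \<le> (1 - b) * p'" using k by simp
      have "p \<le> (1 - k) * a" using kp' a by (simp add: field_simps)
      then show "p' \<le> a" using k by (simp add: scale)
    qed
    moreover have "(a, b - q', a * (b - q')) \<in> T"
    proof (rule edge2)
      have "k * d \<le> (1 - a) * q" using kq' d by (simp add: field_simps)
      then have "k * d \<le> k * ((1 - a) * q')" by (simp add: scale ac_simps)
      then show "d \<le> (1 - a) * q'" using k by simp
      have "q \<le> k * b" using kq b by (simp add: field_simps)
      then show "q' \<le> b" using k by (simp add: scale)
    qed
    ultimately show ?thesis
      unfolding eq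
      by (rule convex_triple_combination[OF convex, of _ _ _ _ _ _ k])
        (use k in \<open>simp_all add: scale algebra_simps\<close>)
  qed
qed

lemma scaled_mem:
  assumes "(u, v, w) \<in> T" "0 \<le> k" "k \<le> 1"
  shows "(k * u, k * v, k * w) \<in> T"
  using convex_triple_combination[OF convex origin assms] by simp

lemma mem:
  assumes w: "0 \<le> w" "w \<le> a * v" "w \<le> b * u" "a * v + b * u - a * b \<le> w" "u + v - w \<le> s"
    and cone: "w * (u + v - w) \<le> s * (u * v)"
  shows "(u, v, w) \<in> T"
proof (cases "u = 0 \<and> v = 0")
  case True
  then show ?thesis using w origin by simp
next
  case False
  have "0 \<le> b * u" "0 \<le> a * v" using w by auto
  then have uv: "0 \<le> u" "0 \<le> v" using a b by (auto simp: zero_le_mult_iff)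
  have a1: "0 < 1 - a" using a s by simp
  \<comment> \<open>Away from the origin \<open>u + v - w\<close> is positive, so the scaling factor
    \<open>k\<close> below is positive.\<close>
  have "0 < u + (1 - a) * v"
    using False uv a1 by (cases "v = 0") (auto intro: add_nonneg_pos)
  also have "\<dots> \<le> u + v - w" using w by (simp add: algebra_simps)
  finally have t: "0 < u + v - w" .
  have s0: "0 < s" and ab: "0 < a * b" using a b by auto
  \<comment> \<open>The least factor for which \<open>(u, v, w) / k\<close> still satisfies both
    inhomogeneous constraints; the maximum is attained, so one of them is tight.\<close>
  define k where "k = max ((u + v - w) / s) ((a * v + b * u - w) / (a * b))"
  have k: "0 < k" "k \<le> 1"
    using t s0 ab w by (auto simp: k_def less_max_iff_disj)
  define U V W where "U = u / k" and "V = v / k" and "W = w / k"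
  have scale: "u = k * U" "v = k * V" "w = k * W"
    using k by (auto simp: U_def V_def W_def)
  have W: "0 \<le> W" "W \<le> a * V" "W \<le> b * U"
    using w k by (auto simp: U_def V_def W_def divide_simps)
  have "(u + v - w) / s \<le> k" "(a * v + b * u - w) / (a * b) \<le> k" by (simp_all add: k_def)
  then have "k * (U + V - W) \<le> k * s" "k * (a * V + b * U - W) \<le> k * (a * b)"
    using s0 ab by (simp_all add: scale field_simps)
  then have bounds: "U + V - W \<le> s" "a * V + b * U - W \<le> a * b"
    using k by simp_all
  have "(k * k) * (W * (U + V - W)) \<le> (k * k) * (s * (U * V))"
    using cone by (simp add: scale algebra_simps)
  then have cone': "W * (U + V - W) \<le> s * (U * V)" using k by simp
  have "0 \<le> V" using uv k by (simp add: V_def)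
  consider "k = (u + v - w) / s" | "k = (a * v + b * u - w) / (a * b)"
    unfolding k_def max_def by meson
  then have "(U, V, W) \<in> T"
  proof cases
    case 1
    then have "k * s = k * (U + V - W)" using s0 by (simp add: scale field_simps)
    then have tight: "W = U + V - s" using k by simp
    \<comment> \<open>With \<open>U + V - W = s\<close> the cone constraint loses a factor
      \<open>s\<close>.\<close>
    have "s * W \<le> s * (U * V)" using cone' by (simp add: tight algebra_simps)
    then have "W \<le> U * V" using s0 by simp
    moreover have "U < 1"
    proof -
      \<comment> \<open>Tightness and \<open>W \<le> a * V\<close> give
        \<open>U \<le> s - (1 - a) * V\<close>, which is at most \<open>s\<close>.\<close>
      have "0 \<le> (1 - a) * V" using a1 \<open>0 \<le> V\<close> by simp
      then show ?thesis using W tight s by (simp add: algebra_simps)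
    qed
    ultimately show ?thesis using cap_mem[of U V] bounds tight by simp
  next
    case 2
    have "k * (a * b) = a * v + b * u - w" unfolding 2 using a b by simp
    then have "k * (a * b) = k * (a * V + b * U - W)" by (simp add: scale algebra_simps)
    then have tight: "W = a * V + b * U - a * b" using k by simp
    \<comment> \<open>On the facet, the two upper bounds on \<open>W\<close> become the box bounds
      on \<open>U\<close> and \<open>V\<close>.\<close>
    have "b * U \<le> b * a" "a * V \<le> a * b" using W tight by (auto simp: mult.commute)
    then have "U \<le> a" "V \<le> b" using a b by simp_all
    then show ?thesis using facet_mem[of V U] W bounds tight by simp
  qed
  then show ?thesis using scaled_mem k scale by simp
qed

end

section \<open>The cone constraint as a norm bound and as a product inequality\<close>

lemma M_mat_quadratic_form:
  "v \<bullet> (M_mat c *v v) = c * (v $ 1 + v $ 2)\<^sup>2 + (1 - c) * (v $ 1 - v $ 2)\<^sup>2"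
  \<comment> \<open>This is the spectral decomposition: eigenvectors \<open>(1, 1)\<close> and
    \<open>(1, -1)\<close>, eigenvalues \<open>2 * c\<close> and \<open>2 * (1 - c)\<close>.\<close>
  by (simp add: M_mat_def inner_vec_def matrix_vector_mult_def sum_2 vector_2
      power2_eq_square algebra_simps)

lemma pos_semidef_M_mat:
  assumes "0 \<le> c" "c \<le> 1"
  shows "pos_semidef (M_mat c)"
  using assms unfolding pos_semidef_def M_mat_quadratic_form
  by (auto simp: M_mat_def transpose_def vec_eq_iff forall_2 vector_2)

text \<open>Exhibits the root as the norm of an affine map, the form from which convexity
  follows.\<close>

lemma sqrt_M_mat_eq_norm:
  assumes "0 \<le> c" "c \<le> 1"
  shows "sqrt (vector [1 - x, 1 - y] \<bullet> (M_mat c *v vector [1 - x, 1 - y]))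
    = norm (sqrt c * (2 - x - y), sqrt (1 - c) * (y - x))"
proof -
  have "1 - x + (1 - y) = 2 - x - y" "1 - x - (1 - y) = y - x" by simp_all
  then show ?thesis
    using assms by (simp only: M_mat_quadratic_form vector_2 norm_Pair)
      (simp add: power_mult_distrib)
qed

text \<open>Squaring leaves four times the product inequality; it is the cone hypothesis of
  \<open>mem\<close>, since \<open>1 - z\<close> is \<open>u + v - w\<close>.\<close>

lemma sqrt_M_mat_le_iff:
  assumes "0 \<le> c" "c \<le> 1"
  shows "sqrt (vector [1 - x, 1 - y] \<bullet> (M_mat c *v vector [1 - x, 1 - y])) \<le> x + y - 2 * z
    \<longleftrightarrow> 0 \<le> x + y - 2 * z \<and> (z - x - y + 1) * (1 - z) \<le> (1 - c) * ((1 - x) * (1 - y))"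
    (is "sqrt ?A \<le> ?B \<longleftrightarrow> _")
proof -
  have "0 \<le> ?A" using pos_semidef_M_mat[OF assms] by (auto simp: pos_semidef_def)
  then have "sqrt ?A \<le> ?B \<longleftrightarrow> 0 \<le> ?B \<and> ?A \<le> ?B\<^sup>2"
    by (meson order_trans real_le_lsqrt real_sqrt_ge_zero sqrt_le_D)
  moreover have "?A \<le> ?B\<^sup>2 \<longleftrightarrow> 0 \<le> ?B\<^sup>2 - ?A" by simp
  moreover have "?B\<^sup>2 - ?A = 4 * ((1 - c) * ((1 - x) * (1 - y)) - (z - x - y + 1) * (1 - z))"
    by (simp add: M_mat_quadratic_form power2_eq_square algebra_simps)
  ultimately show ?thesis by simp
qed

section \<open>Convexity of the relaxation, and the inclusion of \<open>F'\<close> in it\<close>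

lemma convex_norm_le_affine:
  fixes f :: "'a::real_vector \<Rightarrow> 'b::real_normed_vector" and g :: "'a \<Rightarrow> real"
  assumes f: "\<And>p q k. f ((1 - k) *\<^sub>R p + k *\<^sub>R q) = (1 - k) *\<^sub>R f p + k *\<^sub>R f q"
    and g: "\<And>p q k. g ((1 - k) *\<^sub>R p + k *\<^sub>R q) = (1 - k) * g p + k * g q"
  shows "convex {p. norm (f p) \<le> g p}"
  unfolding convex_alt
proof clarify
  fix p q and k :: real
  assume *: "norm (f p) \<le> g p" "norm (f q) \<le> g q" and k: "0 \<le> k" "k \<le> 1"
  have "norm (f ((1 - k) *\<^sub>R p + k *\<^sub>R q)) \<le> norm ((1 - k) *\<^sub>R f p) + norm (k *\<^sub>R f q)"
    unfolding f by (rule norm_triangle_ineq)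
  also have "\<dots> \<le> (1 - k) * g p + k * g q"
    using * k by (simp add: add_mono mult_left_mono)
  finally show "norm (f ((1 - k) *\<^sub>R p + k *\<^sub>R q)) \<le> g ((1 - k) *\<^sub>R p + k *\<^sub>R q)"
    unfolding g .
qed

lemma convex_affine_le:
  "convex {(x, y, z). \<alpha> * x + \<beta> * y + \<gamma> * z \<le> (\<delta> :: real)}"
proof -
  have "{(x, y, z). \<alpha> * x + \<beta> * y + \<gamma> * z \<le> \<delta>} = {p. (\<alpha>, \<beta>, \<gamma>) \<bullet> p \<le> \<delta>}" by auto
  then show ?thesis using convex_halfspace_le by metis
qed

definition rlt_soc_set :: "real \<Rightarrow> real \<Rightarrow> real \<Rightarrow> (real \<times> real \<times> real) set" where
  "rlt_soc_set lx ly lz =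
     {(x, y, z).
         z \<ge> x + y - 1 \<and>
         z \<ge> ly * x + lx * y - lx * ly \<and>
         z \<le> x + lx * y - lx \<and>
         z \<le> ly * x + y - ly \<and>
         z \<ge> lz \<and>
         (let v = (vector [1 - x, 1 - y] :: real ^ 2)
          in sqrt (v \<bullet> (M_mat lz *v v)) \<le> x + y - 2 * z)}"

lemma convex_rlt_soc_set:
  assumes "0 \<le> lz" "lz \<le> 1"
  shows "convex (rlt_soc_set lx ly lz)"
proof -
  \<comment> \<open>Coefficients 0, 1 and -1 are spelled out so that each half-space matches
    \<open>convex_affine_le\<close>.\<close>
  have "rlt_soc_set lx ly lz =
      {(x, y, z). 1 * x + 1 * y + (- 1) * z \<le> 1}
      \<inter> {(x, y, z). ly * x + lx * y + (- 1) * z \<le> lx * ly}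
      \<inter> {(x, y, z). (- 1) * x + (- lx) * y + 1 * z \<le> - lx}
      \<inter> {(x, y, z). (- ly) * x + (- 1) * y + 1 * z \<le> - ly}
      \<inter> {(x, y, z). 0 * x + 0 * y + (- 1) * z \<le> - lz}
      \<inter> {p. norm (sqrt lz * (2 - fst p - fst (snd p)), sqrt (1 - lz) * (fst (snd p) - fst p))
            \<le> fst p + fst (snd p) - 2 * snd (snd p)}"
    unfolding rlt_soc_set_def Let_def sqrt_M_mat_eq_norm[OF assms] by auto
  moreover have "convex {p :: real \<times> real \<times> real.
      norm (sqrt lz * (2 - fst p - fst (snd p)), sqrt (1 - lz) * (fst (snd p) - fst p))
        \<le> fst p + fst (snd p) - 2 * snd (snd p)}"
    by (rule convex_norm_le_affine) (auto simp: algebra_simps)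
  ultimately show ?thesis
    by (simp only: convex_Int convex_affine_le)
qed

lemma F'_subset_rlt_soc_set:
  assumes "0 \<le> lx" "0 \<le> ly" "0 \<le> lz" "lz \<le> 1"
  shows "F' lx ly lz \<subseteq> rlt_soc_set lx ly lz"
proof clarify
  fix x y z
  assume "(x, y, z) \<in> F' lx ly lz"
  then have z: "z = x * y" and xy: "lx \<le> x" "x \<le> 1" "ly \<le> y" "y \<le> 1" "lz \<le> x * y"
    by (auto simp: F'_def)
  then have "0 \<le> x" "0 \<le> y" using assms by simp_all
  \<comment> \<open>The first four products are the RLT inequalities at \<open>z = x * y\<close>;
    the last two add up to \<open>x + y - 2 * z\<close>.\<close>
  then have box: "0 \<le> (1 - x) * (1 - y)" "0 \<le> (x - lx) * (y - ly)"
    "0 \<le> (x - lx) * (1 - y)" "0 \<le> (1 - x) * (y - ly)"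
    "0 \<le> x * (1 - y)" "0 \<le> (1 - x) * y"
    using xy by (intro mult_nonneg_nonneg; simp)+
  \<comment> \<open>On the surface \<open>z - x - y + 1\<close> factors as
    \<open>(1 - x) * (1 - y)\<close>, so the cone constraint follows from
    \<open>lz \<le> z\<close>.\<close>
  have "(1 - lz) * ((1 - x) * (1 - y)) \<ge> (1 - x * y) * ((1 - x) * (1 - y))"
    using box(1) xy by (intro mult_right_mono) simp_all
  also have "(1 - x * y) * ((1 - x) * (1 - y)) = (z - x - y + 1) * (1 - z)"
    by (simp add: z algebra_simps)
  finally have cone: "(z - x - y + 1) * (1 - z) \<le> (1 - lz) * ((1 - x) * (1 - y))" .
  have "z \<ge> x + y - 1" "z \<ge> ly * x + lx * y - lx * ly" "z \<le> x + lx * y - lx"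
    "z \<le> ly * x + y - ly" "0 \<le> x + y - 2 * z"
    using box unfolding z by (simp_all add: algebra_simps)
  then show "(x, y, z) \<in> rlt_soc_set lx ly lz"
    using cone xy(5) z by (simp add: rlt_soc_set_def Let_def sqrt_M_mat_le_iff[OF assms(3,4)])
qed

section \<open>The relaxation lies in the hull\<close>

lemma rlt_soc_set_subset_hull:
  assumes "0 < lx" "0 < ly" "lx * ly < lz" "0 < lz" "lz \<le> lx" "lx < 1" "lz \<le> ly" "ly < 1"
  shows "rlt_soc_set lx ly lz \<subseteq> convex hull (F' lx ly lz)"
proof clarify
  \<comment> \<open>The hull in the coordinates \<open>(u, v, w)\<close>. The locale condition
    \<open>s < a + b - a * b\<close> becomes \<open>lx * ly < lz\<close>.\<close>
  define T where "T = {(u, v, w). (1 - u, 1 - v, 1 - u - v + w) \<in> convex hull (F' lx ly lz)}"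
  interpret truncated_bilinear_patch "1 - lx" "1 - ly" "1 - lz" T
  proof
    show "convex T"
      unfolding convex_alt
    proof clarify
      fix u v w u' v' w' k :: real
      assume mem: "(u, v, w) \<in> T" "(u', v', w') \<in> T" and k: "0 \<le> k" "k \<le> 1"
      have "(1 - ((1 - k) * u + k * u'), 1 - ((1 - k) * v + k * v'),
          1 - ((1 - k) * u + k * u') - ((1 - k) * v + k * v') + ((1 - k) * w + k * w'))
        \<in> convex hull (F' lx ly lz)"
        using mem unfolding T_def mem_Collect_eq prod.case
        by (rule convex_triple_combination[OF convex_convex_hull _ _ k])
          (simp_all add: algebra_simps)
      then show "(1 - k) *\<^sub>R (u, v, w) + k *\<^sub>R (u', v', w') \<in> T"
        by (simp add: T_def)
    qed
    fix u v :: real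
    assume uv: "0 \<le> u" "u \<le> 1 - lx" "0 \<le> v" "v \<le> 1 - ly" "u + v - u * v \<le> 1 - lz"
    then have "(1 - u) * (1 - v) \<le> 1" using assms by (intro mult_le_one) simp_all
    then have "(1 - u, 1 - v, 1 - u - v + u * v) \<in> F' lx ly lz"
      using uv by (auto simp: F'_def algebra_simps)
    then show "(u, v, u * v) \<in> T"
      unfolding T_def by (auto intro: hull_inc)
  qed (use assms in \<open>auto simp: algebra_simps\<close>)
  fix x y z
  assume *: "(x, y, z) \<in> rlt_soc_set lx ly lz"
  then have cone: "(z - x - y + 1) * (1 - z) \<le> (1 - lz) * ((1 - x) * (1 - y))"
    using assms sqrt_M_mat_le_iff[of lz x y z] by (auto simp: rlt_soc_set_def)
  have "(1 - x, 1 - y, z - x - y + 1) \<in> T"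
    \<comment> \<open>The RLT inequalities become the four bounds on \<open>w\<close>, and
      \<open>z \<ge> lz\<close> becomes \<open>u + v - w \<le> s\<close>.\<close>
    using * cone by (intro mem) (auto simp: rlt_soc_set_def algebra_simps)
  then show "(x, y, z) \<in> convex hull (F' lx ly lz)" by (simp add: T_def)
qed

theorem proposition4:
  fixes lx ly lz :: real
  assumes "0 \<le> lx * ly" and "lx * ly < lz" and "lz < 1"
    and "lz \<le> lx" and "lx < 1"
    and "lz \<le> ly" and "ly < 1"
  shows "pos_semidef (M_mat lz) \<and>
    convex hull (F' lx ly lz) =
      {(x, y, z).
         z \<ge> x + y - 1 \<and>
         z \<ge> ly * x + lx * y - lx * ly \<and>
         z \<le> x + lx * y - lx \<and>
         z \<le> ly * x + y - ly \<and>
         z \<ge> lz \<and>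
         (let v = (vector [1 - x, 1 - y] :: real ^ 2)
          in sqrt (v \<bullet> (M_mat lz *v v)) \<le> x + y - 2 * z)}"
proof -
  have pos: "0 < lz" "0 < lx" "0 < ly" using assms by linarith+
  then have "convex hull (F' lx ly lz) \<subseteq> rlt_soc_set lx ly lz"
    using assms by (intro hull_minimal F'_subset_rlt_soc_set convex_rlt_soc_set) auto
  then have "convex hull (F' lx ly lz) = rlt_soc_set lx ly lz"
    using rlt_soc_set_subset_hull pos assms by blast
  then show ?thesis
    using pos_semidef_M_mat pos assms unfolding rlt_soc_set_def by simp
qed

end
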